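(* Let $n\ge 2$, let $\alpha_1,\dots,\alpha_n>0$ be pairwise distinct, let $c>0$, let $X_1,\dots,X_n$ be independent with $X_i\sim \mathrm{Exp}(\alpha_i)$, and set $k=\frac1c$, $\lambda_i=\alpha_i$ and $Y_i=c\,e^{-X_i}$. Then $Y_i\sim \mathrm{Power}(k,\lambda_i)$, with domain $(0,c)$, for each $i$, and the Mixed Hypoexponential Power distribution $Z\sim MHP(k,\lambda_1,\dots,\lambda_n)$, i.e. the mixed T-G distribution generated from the hypoexponential distribution with parameters $(\alpha_1,\dots,\alpha_n)$ and the transformation $x\mapsto c\,e^{-x}$, has PDF $$f_Z(t)=\sum_{i=1}^n\frac{1}{PP_i}f_{Y_i}(t),\qquad PP_i=\prod_{j=1,\,j\ne i}^{n}\left(1-\frac{\lambda_i}{\lambda_j}\right).$$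
   Context: $\mathrm{Exp}(\alpha)$ has density $\alpha e^{-\alpha t}$ for $t>0$. The hypoexponential distribution with pairwise distinct parameters $\alpha_1,\dots,\alpha_n>0$ is the law of $T=\sum_{i=1}^nX_i$ with $X_i\sim\mathrm{Exp}(\alpha_i)$ independent; its density is $f_{T}(t)=\sum_{i=1}^n\frac{f_{X_i}(t)}{P_i}$, $t>0$, where $P_i=\prod_{j\ne i}\left(1-\frac{\alpha_i}{\alpha_j}\right)$ (known fact). If a distribution $T$ has density $\sum_iA_if_{X_i}$ with $A_i\in\mathbb{R}$, $\sum_iA_i=1$, and $g$ is a one-to-one function, the mixed T-G distribution generated from $T$ and $g$ is the distribution with density $\sum_iA_if_{g(X_i)}$. $\mathrm{Power}(k,\lambda)$ with domain parameter $k>0$ and shape parameter $\lambda>0$ has density $\lambda k^{\lambda}t^{\lambda-1}$ for $0<t<\frac1k$. *)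

theory Defs
  imports "HOL-Probability.Probability"
begin

text \<open>
  Nonnegativity is required explicitly because \<open>ennreal\<close> maps negative reals to 0: without it a
  signed combination of densities would silently be truncated. It is only required almost
  everywhere since densities are determined only up to null sets.
\<close>

definition has_pdf :: "real measure \<Rightarrow> (real \<Rightarrow> real) \<Rightarrow> bool" where
  "has_pdf N f \<longleftrightarrow>
     f \<in> borel_measurable borel \<and>
     (AE t in lborel. 0 \<le> f t) \<and>
     N = density lborel (\<lambda>t. ennreal (f t))"

definition power_density :: "real \<Rightarrow> real \<Rightarrow> real \<Rightarrow> real" where
  "power_density k l t =
     (if 0 < t \<and> t < 1 / k then l * k powr l * t powr (l - 1) else 0)"

text \<open>
  The law of a sum of \<open>n\<close> independent exponential variables, realised as the coordinates of the
  product space; lemma \<open>distr_sum_eq_hypoexponential\<close> below shows that any other choice of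
  independent variables yields the same law.
\<close>

definition hypoexponential :: "nat \<Rightarrow> (nat \<Rightarrow> real) \<Rightarrow> real measure" where
  "hypoexponential n \<alpha> =
     distr (\<Pi>\<^sub>M i\<in>{1..n}. density lborel (\<lambda>t. ennreal (exponential_density (\<alpha> i) t)))
       borel (\<lambda>x. \<Sum>i=1..n. x i)"

definition PP :: "nat \<Rightarrow> (nat \<Rightarrow> real) \<Rightarrow> nat \<Rightarrow> real" where
  "PP n l i = (\<Prod>j\<in>{1..n} - {i}. 1 - l i / l j)"

text \<open>
  \<open>mixed_TG M I X T g Z\<close>: the law \<open>Z\<close> is a mixed T-G distribution generated from the law \<open>T\<close> and
  the one-to-one function \<open>g\<close>, where the density of \<open>T\<close> is an affine combination of densities
  \<open>f i\<close> of the variables \<open>X i\<close>; the \<open>h i\<close> are densities of the variables \<open>g (X i)\<close>. The coefficients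
  and the versions of the densities are existentially quantified, so neither existence nor
  uniqueness of \<open>Z\<close> is built in.
\<close>

definition mixed_TG ::
    "'a measure \<Rightarrow> 'i set \<Rightarrow> ('i \<Rightarrow> 'a \<Rightarrow> real) \<Rightarrow> real measure \<Rightarrow> (real \<Rightarrow> real) \<Rightarrow> real measure \<Rightarrow> bool"
  where
  "mixed_TG M I X T g Z \<longleftrightarrow>
     finite I \<and> (\<forall>i\<in>I. X i \<in> borel_measurable M) \<and>
     inj g \<and> g \<in> borel_measurable borel \<and>
     (\<exists>A f h.
        (\<Sum>i\<in>I. A i) = 1 \<and>
        (\<forall>i\<in>I. has_pdf (distr M borel (X i)) (f i)) \<and>
        has_pdf T (\<lambda>t. \<Sum>i\<in>I. A i * f i t) \<and>
        (\<forall>i\<in>I. has_pdf (distr M borel (\<lambda>\<omega>. g (X i \<omega>))) (h i)) \<and>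
        has_pdf Z (\<lambda>t. \<Sum>i\<in>I. A i * h i t))"

lemma distr_sum_eq_hypoexponential:
  assumes "prob_space M"
    and "1 \<le> n"
    and indep: "prob_space.indep_vars M (\<lambda>_. borel) X {1..n}"
    and exp: "\<And>i. i \<in> {1..n} \<Longrightarrow> distributed M lborel (X i) (exponential_density (\<alpha> i))"
  shows "distr M borel (\<lambda>\<omega>. \<Sum>i=1..n. X i \<omega>) = hypoexponential n \<alpha>"
proof -
  interpret prob_space M by fact
  have rv: "X i \<in> borel_measurable M" if "i \<in> {1..n}" for i
    using indep that by (auto simp: indep_vars_def)
  have law: "distr M borel (X i) = density lborel (\<lambda>t. ennreal (exponential_density (\<alpha> i) t))"
    if "i \<in> {1..n}" for i
  proof -
    have "distr M borel (X i) = distr M lborel (X i)"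
      by (rule distr_cong) auto
    then show ?thesis
      using exp[OF that] by (simp add: distributed_def)
  qed
  have joint: "distr M (\<Pi>\<^sub>M i\<in>{1..n}. borel) (\<lambda>\<omega>. \<lambda>i\<in>{1..n}. X i \<omega>) =
      (\<Pi>\<^sub>M i\<in>{1..n}. distr M borel (X i))"
    using indep_vars_iff_distr_eq_PiM'[of "{1..n}" X "\<lambda>_. borel"] indep rv \<open>1 \<le> n\<close> by auto
  also have "\<dots> = (\<Pi>\<^sub>M i\<in>{1..n}. density lborel (\<lambda>t. ennreal (exponential_density (\<alpha> i) t)))"
    by (rule PiM_cong) (use law in auto)
  finally have "hypoexponential n \<alpha> = 
      distr (distr M (\<Pi>\<^sub>M i\<in>{1..n}. borel) (\<lambda>\<omega>. \<lambda>i\<in>{1..n}. X i \<omega>)) borel (\<lambda>x. \<Sum>i=1..n. x i)"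
    by (simp add: hypoexponential_def)
  also have "\<dots> = distr M borel ((\<lambda>x. \<Sum>i=1..n. x i) \<circ> (\<lambda>\<omega>. \<lambda>i\<in>{1..n}. X i \<omega>))"
    by (rule distr_distr) (use rv in \<open>auto intro!: measurable_restrict borel_measurable_sum\<close>)
  also have "\<dots> = distr M borel (\<lambda>\<omega>. \<Sum>i=1..n. X i \<omega>)"
    by (rule distr_cong) auto
  finally show ?thesis by simp
qed

end

theory Submission
  imports Defs
begin

text \<open>
  Induction on the number of summands, with one convolution per step, gives the hypoexponential
  density; the coefficient of the new summand comes out right because the coefficients sum to 1.
  If the density of \<open>T\<close> is a signed mixture of the densities of the \<open>X i\<close>, then
  \<open>P(Z \<in> B) = (\<Sum>i. A i * P(g (X i) \<in> B)) = P(T \<in> g -` B)\<close>, so a mixed T-G law is the image of \<open>T\<close>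
  under \<open>g\<close> whatever representation of \<open>T\<close> is used. Hence it is unique, and the representation by the
  coefficients \<open>1 / PP n lam i\<close> determines its density.
\<close>

subsection \<open>The density of the hypoexponential distribution\<close>

text \<open>The left-hand side is the value at 0 of the Lagrange interpolation polynomial of the constant 1.\<close>

lemma sum_inverse_prod_one_minus_ratio:
  fixes \<alpha> :: "'i \<Rightarrow> real"
  assumes "finite I" "I \<noteq> {}" "inj_on \<alpha> I" and nz: "\<And>i. i \<in> I \<Longrightarrow> \<alpha> i \<noteq> 0"
  shows "(\<Sum>i\<in>I. 1 / (\<Prod>j\<in>I - {i}. 1 - \<alpha> i / \<alpha> j)) = 1"
proof -
  \<comment> \<open>The Lagrange interpolant of the constant 1 at the nodes
    \<open>\<alpha> i\<close>, its basis polynomials built from the factors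
    \<open>1 - x / \<alpha> j\<close>, all of which equal 1 at \<open>x = 0\<close>.\<close>
  define p where "p = (\<Sum>i\<in>I. Polynomial.smult (1 / (\<Prod>j\<in>I - {i}. 1 - \<alpha> i / \<alpha> j))
    (\<Prod>j\<in>I - {i}. [:1, - 1 / \<alpha> j:]))"
  have card: "0 < card I"
    using assms by (simp add: card_gt_0_iff)
  have poly_p: "poly p x =
      (\<Sum>i\<in>I. 1 / (\<Prod>j\<in>I - {i}. 1 - \<alpha> i / \<alpha> j) * (\<Prod>j\<in>I - {i}. 1 - x / \<alpha> j))" for x
    by (simp add: p_def poly_sum poly_prod)
  have "poly p (\<alpha> k) = 1" if k: "k \<in> I" for k
  proof -
    \<comment> \<open>For \<open>i \<noteq> k\<close> the factor with \<open>j = k\<close> vanishes,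
      so only the \<open>k\<close>-th basis polynomial survives at the node
      \<open>\<alpha> k\<close>.\<close>
    have "(\<Prod>j\<in>I - {i}. 1 - \<alpha> k / \<alpha> j) = 0" if "i \<noteq> k" for i
      using k that assms(1) nz[OF k] by (intro prod_zero) auto
    moreover have "(\<Prod>j\<in>I - {k}. 1 - \<alpha> k / \<alpha> j) \<noteq> 0"
      using k assms nz by (auto simp: prod_zero_iff inj_on_def)
    ultimately show ?thesis
      unfolding poly_p using k assms(1) by (simp add: sum.remove[of I k] del: prod_zero_iff)
  qed
  moreover have "degree p < card I"
  proof -
    have "degree p \<le> card I - 1"
      unfolding p_def
    proof (intro degree_sum_le order.trans[OF degree_smult_le])
      fix i assume i: "i \<in> I"
      have "degree (\<Prod>j\<in>I - {i}. [:1, - 1 / \<alpha> j:]) \<le> (\<Sum>j\<in>I - {i}. degree [:1, - 1 / \<alpha> j:])"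
        using degree_prod_sum_le[of "I - {i}" "\<lambda>j. [:1, - 1 / \<alpha> j:]"] assms(1) by (simp add: o_def)
      also have "\<dots> \<le> (\<Sum>j\<in>I - {i}. 1)"
        by (intro sum_mono) auto
      finally show "degree (\<Prod>j\<in>I - {i}. [:1, - 1 / \<alpha> j:]) \<le> card I - 1"
        using i assms(1) by simp
    qed (use assms in auto)
    then show ?thesis using card by simp
  qed
  \<comment> \<open>Both polynomials have degree below \<open>card I\<close> and agree at
    \<open>card I\<close> distinct nodes. At 0 the products in the numerators are 1, which leaves
    the sum of the coefficients.\<close>
  ultimately have "p = 1"
    using card card_image[OF assms(3)] by (intro poly_eqI_degree[of "\<alpha> ` I"]) auto
  then show ?thesis
    using poly_p[of 0] by simp
qed

text \<open>An arbitrary index set in place of \<open>{1..n}\<close> lets the induction add one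
  index at a time. The coefficients may be negative, so nonnegativity of the combination is a
  separate fact.\<close>

definition hypoexponential_density :: "'i set \<Rightarrow> ('i \<Rightarrow> real) \<Rightarrow> real \<Rightarrow> real" where
  "hypoexponential_density I \<alpha> t =
     (\<Sum>i\<in>I. 1 / (\<Prod>j\<in>I - {i}. 1 - \<alpha> i / \<alpha> j) * exponential_density (\<alpha> i) t)"

lemma borel_measurable_hypoexponential_density [measurable]:
  "hypoexponential_density I \<alpha> \<in> borel_measurable borel"
  unfolding hypoexponential_density_def[abs_def] by measurable

text \<open>The new index multiplies the \<open>i\<close>-th coefficient by
  \<open>\<alpha> a / (\<alpha> a - \<alpha> i)\<close>. Since the coefficients sum to 1 before and
  after, the new one can be distributed over \<open>I\<close>; each summand then becomes a multiple
  of the convolution of the exponential densities with rates \<open>\<alpha> i\<close> and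
  \<open>\<alpha> a\<close>.\<close>

lemma hypoexponential_density_insert:
  assumes "finite I" "I \<noteq> {}" "a \<notin> I" "inj_on \<alpha> (insert a I)"
    and pos: "\<And>i. i \<in> insert a I \<Longrightarrow> 0 < \<alpha> i" and x: "0 \<le> x"
  shows "hypoexponential_density (insert a I) \<alpha> x =
    (\<Sum>i\<in>I. 1 / (\<Prod>j\<in>I - {i}. 1 - \<alpha> i / \<alpha> j) * (\<alpha> i * \<alpha> a / (\<alpha> a - \<alpha> i)) *
       (exp (- (\<alpha> i * x)) - exp (- (\<alpha> a * x))))"
proof -
  define A where "A i = 1 / (\<Prod>j\<in>I - {i}. 1 - \<alpha> i / \<alpha> j)" for i
  define C where "C = 1 / (\<Prod>j\<in>I. 1 - \<alpha> a / \<alpha> j)"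
  have neq: "\<alpha> a \<noteq> \<alpha> i" if "i \<in> I" for i
    using assms(3,4) that by (auto simp: inj_on_def)
  have coeff: "1 / (\<Prod>j\<in>insert a I - {i}. 1 - \<alpha> i / \<alpha> j) = A i * (\<alpha> a / (\<alpha> a - \<alpha> i))" if "i \<in> I" for i
  proof -
    have "insert a I - {i} = insert a (I - {i})"
      using that assms(3) by auto
    then have "(\<Prod>j\<in>insert a I - {i}. 1 - \<alpha> i / \<alpha> j) = (1 - \<alpha> i / \<alpha> a) * (\<Prod>j\<in>I - {i}. 1 - \<alpha> i / \<alpha> j)"
      using assms(1,3) by simp
    moreover have "1 - \<alpha> i / \<alpha> a = (\<alpha> a - \<alpha> i) / \<alpha> a"
      using pos[of a] by (simp add: field_simps)
    ultimately show ?thesis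
      by (simp add: A_def)
  qed
  have coeff_a: "1 / (\<Prod>j\<in>insert a I - {a}. 1 - \<alpha> a / \<alpha> j) = C"
    using assms(3) by (simp add: C_def)
  have "(\<Sum>i\<in>I. A i) = 1"
    unfolding A_def using assms pos
    by (intro sum_inverse_prod_one_minus_ratio) (force simp: inj_on_def)+
  moreover have "C + (\<Sum>i\<in>I. A i * (\<alpha> a / (\<alpha> a - \<alpha> i))) = 1"
  proof -
    have "(\<Sum>i\<in>insert a I. 1 / (\<Prod>j\<in>insert a I - {i}. 1 - \<alpha> i / \<alpha> j)) = 1"
      using assms pos by (intro sum_inverse_prod_one_minus_ratio) force+
    then show ?thesis
      unfolding sum.insert[OF assms(1,3)] coeff_a by (simp add: coeff del: insert_Diff_if)
  qed
  \<comment> \<open>The two normalisations determine \<open>C\<close>, so its product formula never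
    has to be expanded.\<close>
  ultimately have C: "C = (\<Sum>i\<in>I. A i - A i * (\<alpha> a / (\<alpha> a - \<alpha> i)))"
    by (simp add: sum_subtractf)
  have summand: "(A i - A i * (\<alpha> a / (\<alpha> a - \<alpha> i))) * (\<alpha> a * u) + A i * (\<alpha> a / (\<alpha> a - \<alpha> i)) * (\<alpha> i * v) =
    A i * (\<alpha> i * \<alpha> a / (\<alpha> a - \<alpha> i)) * (v - u)" if "i \<in> I" for i u v
  proof -
    \<comment> \<open>With \<open>w\<close> in place of the quotient, the claim is a polynomial
      identity modulo the single relation
      \<open>\<alpha> a * w = 1 + \<alpha> i * w\<close>.\<close>
    define w where "w = inverse (\<alpha> a - \<alpha> i)"
    have "\<alpha> a * w = 1 + \<alpha> i * w"
      using neq[OF that] by (simp add: w_def field_simps)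
    then show ?thesis
      unfolding divide_inverse w_def[symmetric] by algebra
  qed
  have "hypoexponential_density (insert a I) \<alpha> x = C * exponential_density (\<alpha> a) x +
      (\<Sum>i\<in>I. A i * (\<alpha> a / (\<alpha> a - \<alpha> i)) * exponential_density (\<alpha> i) x)"
    unfolding hypoexponential_density_def sum.insert[OF assms(1,3)] coeff_a
    by (intro arg_cong2[where f = "(+)"] refl sum.cong) (simp only: coeff)
  also have "\<dots> = C * (\<alpha> a * exp (- (\<alpha> a * x))) +
      (\<Sum>i\<in>I. A i * (\<alpha> a / (\<alpha> a - \<alpha> i)) * (\<alpha> i * exp (- (\<alpha> i * x))))"
    using x by (simp add: exponential_density_def mult.commute[of x])
  also have "\<dots> = (\<Sum>i\<in>I. (A i - A i * (\<alpha> a / (\<alpha> a - \<alpha> i))) * (\<alpha> a * exp (- (\<alpha> a * x))) +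
      A i * (\<alpha> a / (\<alpha> a - \<alpha> i)) * (\<alpha> i * exp (- (\<alpha> i * x))))"
    by (simp add: C sum_distrib_right sum.distrib)
  also have "\<dots> = (\<Sum>i\<in>I. A i * (\<alpha> i * \<alpha> a / (\<alpha> a - \<alpha> i)) * (exp (- (\<alpha> i * x)) - exp (- (\<alpha> a * x))))"
    by (intro sum.cong refl summand)
  finally show ?thesis
    by (simp add: A_def)
qed

text \<open>The integrand is nonnegative and has an explicit antiderivative \<open>H\<close> on
  \<open>[0, x]\<close>, and the claimed density at \<open>x\<close> is \<open>H x - H 0\<close>.
  One computation thus yields both the value of the integral and the nonnegativity that the next
  induction step requires.\<close>

lemma hypoexponential_density_convolution:
  assumes "finite I" "I \<noteq> {}" "a \<notin> I" "inj_on \<alpha> (insert a I)"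
    and pos: "\<And>i. i \<in> insert a I \<Longrightarrow> 0 < \<alpha> i"
    and nonneg: "\<And>t. 0 \<le> hypoexponential_density I \<alpha> t"
  shows "0 \<le> hypoexponential_density (insert a I) \<alpha> x"
    and "(\<integral>\<^sup>+ y. ennreal (exponential_density (\<alpha> a) (x - y)) * ennreal (hypoexponential_density I \<alpha> y) \<partial>lborel) =
      ennreal (hypoexponential_density (insert a I) \<alpha> x)"
proof -
  let ?G = "\<lambda>y. exponential_density (\<alpha> a) (x - y) * hypoexponential_density I \<alpha> y"
  have G0: "0 \<le> ?G y" for y
    using pos nonneg by (intro mult_nonneg_nonneg) (auto simp: less_imp_le)
  have "0 \<le> hypoexponential_density (insert a I) \<alpha> x \<and>
    (\<integral>\<^sup>+ y. ennreal (?G y) \<partial>lborel) = ennreal (hypoexponential_density (insert a I) \<alpha> x)"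
  proof (cases "0 \<le> x")
    case False
    then have "?G y = 0" for y
      by (cases "y < 0") (auto simp: hypoexponential_density_def exponential_density_def)
    then have "(\<integral>\<^sup>+ y. ennreal (?G y) \<partial>lborel) = 0"
      by (simp only: ennreal_0 nn_integral_const mult_zero_left)
    moreover have "hypoexponential_density (insert a I) \<alpha> x = 0"
      using False by (simp add: hypoexponential_density_def exponential_density_def)
    ultimately show ?thesis
      by simp
  next
    case x: True
    define A where "A i = 1 / (\<Prod>j\<in>I - {i}. 1 - \<alpha> i / \<alpha> j)" for i
    \<comment> \<open>On \<open>[0, x]\<close> the two exponentials merge into one with rate
      \<open>\<alpha> a - \<alpha> i\<close> in \<open>y\<close>; integrating it divides by this
      nonzero difference.\<close>
    define H where "H y = (\<Sum>i\<in>I. A i * (\<alpha> i * \<alpha> a / (\<alpha> a - \<alpha> i)) * exp ((\<alpha> a - \<alpha> i) * y - \<alpha> a * x))" for y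
    have neq: "\<alpha> a \<noteq> \<alpha> i" if "i \<in> I" for i
      using assms(3,4) that by (auto simp: inj_on_def)
    have deriv: "(H has_real_derivative ?G y) (at y)" if "0 \<le> y" "y \<le> x" for y
    proof -
      have "?G y = (\<Sum>i\<in>I. A i * (\<alpha> i * \<alpha> a / (\<alpha> a - \<alpha> i)) *
          (exp ((\<alpha> a - \<alpha> i) * y - \<alpha> a * x) * (\<alpha> a - \<alpha> i)))"
        unfolding hypoexponential_density_def sum_distrib_left
      proof (intro sum.cong refl)
        fix i assume "i \<in> I"
        have "exponential_density (\<alpha> a) (x - y) * exponential_density (\<alpha> i) y =
            \<alpha> i * \<alpha> a * exp ((\<alpha> a - \<alpha> i) * y - \<alpha> a * x)"
          using that by (simp add: exponential_density_def exp_add[symmetric] algebra_simps)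
        then show "exponential_density (\<alpha> a) (x - y) *
             (1 / (\<Prod>j\<in>I - {i}. 1 - \<alpha> i / \<alpha> j) * exponential_density (\<alpha> i) y) =
           A i * (\<alpha> i * \<alpha> a / (\<alpha> a - \<alpha> i)) * (exp ((\<alpha> a - \<alpha> i) * y - \<alpha> a * x) * (\<alpha> a - \<alpha> i))"
          using neq[OF \<open>i \<in> I\<close>] by (simp add: A_def[symmetric] field_simps)
      qed
      moreover have "(H has_real_derivative \<dots>) (at y)"
        unfolding H_def by (intro DERIV_sum) (auto intro!: derivative_eq_intros)
      ultimately show ?thesis
        by simp
    qed
    have "hypoexponential_density (insert a I) \<alpha> x =
        (\<Sum>i\<in>I. A i * (\<alpha> i * \<alpha> a / (\<alpha> a - \<alpha> i)) * (exp (- (\<alpha> i * x)) - exp (- (\<alpha> a * x))))"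
      unfolding A_def using assms(1-4) pos x by (intro hypoexponential_density_insert) auto
    also have "\<dots> = H x - H 0"
      unfolding H_def sum_subtractf[symmetric] right_diff_distrib[symmetric]
      by (intro sum.cong refl) (simp add: algebra_simps)
    finally have "hypoexponential_density (insert a I) \<alpha> x = H x - H 0" .
    moreover have "H 0 \<le> H x"
      using deriv G0 x by (intro DERIV_nonneg_imp_nondecreasing[of 0 x H]) auto
    \<comment> \<open>Outside \<open>[0, x]\<close> one of the two densities has a negative argument
      and vanishes.\<close>
    moreover have "(\<integral>\<^sup>+ y. ennreal (?G y) \<partial>lborel) = (\<integral>\<^sup>+ y. ennreal (?G y) * indicator {0..x} y \<partial>lborel)"
      by (intro nn_integral_cong)
        (auto simp: hypoexponential_density_def exponential_density_def split: split_indicator)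
    moreover have "(\<integral>\<^sup>+ y. ennreal (?G y) * indicator {0..x} y \<partial>lborel) = ennreal (H x - H 0)"
      using deriv G0 x by (intro nn_integral_FTC_Icc) (auto intro: DERIV_subset)
    ultimately show ?thesis
      by simp
  qed
  then show "0 \<le> hypoexponential_density (insert a I) \<alpha> x"
    and "(\<integral>\<^sup>+ y. ennreal (exponential_density (\<alpha> a) (x - y)) * ennreal (hypoexponential_density I \<alpha> y) \<partial>lborel) =
      ennreal (hypoexponential_density (insert a I) \<alpha> x)"
    using pos nonneg by (simp_all add: ennreal_mult less_imp_le)
qed

lemma hypoexponential_density_nonneg:
  assumes "finite I" "inj_on \<alpha> I" "\<And>i. i \<in> I \<Longrightarrow> 0 < \<alpha> i"
  shows "0 \<le> hypoexponential_density I \<alpha> t"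
proof (cases "I = {}")
  case False
  with assms(1) show ?thesis
    using assms(2,3)
  proof (induction arbitrary: t rule: finite_ne_induct)
    case (singleton i)
    then show ?case
      by (simp add: hypoexponential_density_def exponential_density_nonneg)
  next
    case (insert a I)
    then show ?case
      by (intro hypoexponential_density_convolution(1)) auto
  qed
qed (simp add: hypoexponential_density_def)

text \<open>By independence of \<open>X a\<close> from the partial sum over \<open>I\<close>, adding
  \<open>X a\<close> convolves the densities, and the convolution has already been
  evaluated.\<close>

lemma (in prob_space) distributed_sum_exponential:
  assumes "finite I" "I \<noteq> {}" "inj_on \<alpha> I" "\<And>i. i \<in> I \<Longrightarrow> 0 < \<alpha> i"
    and "indep_vars (\<lambda>_. borel) X I"
    and "\<And>i. i \<in> I \<Longrightarrow> distributed M lborel (X i) (exponential_density (\<alpha> i))"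
  shows "distributed M lborel (\<lambda>\<omega>. \<Sum>i\<in>I. X i \<omega>) (hypoexponential_density I \<alpha>)"
  using assms
proof (induction rule: finite_ne_induct)
  case (singleton i)
  then show ?case
    by (simp add: hypoexponential_density_def[abs_def])
next
  case (insert a I)
  have inj: "inj_on \<alpha> I"
    using insert.prems(1) by (auto simp: inj_on_def)
  have "distributed M lborel (\<lambda>\<omega>. \<Sum>i\<in>I. X i \<omega>) (hypoexponential_density I \<alpha>)"
    using insert.prems inj by (intro insert.IH) (auto intro: indep_vars_subset)
  then have "distributed M lborel (\<lambda>\<omega>. X a \<omega> + (\<Sum>i\<in>I. X i \<omega>))
      (\<lambda>x. \<integral>\<^sup>+ y. ennreal (exponential_density (\<alpha> a) (x - y)) * ennreal (hypoexponential_density I \<alpha> y) \<partial>lborel)"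
    using insert.hyps insert.prems by (intro distributed_convolution indep_vars_sum) auto
  also have "(\<lambda>x. \<integral>\<^sup>+ y. ennreal (exponential_density (\<alpha> a) (x - y)) * ennreal (hypoexponential_density I \<alpha> y) \<partial>lborel) =
      (\<lambda>x. ennreal (hypoexponential_density (insert a I) \<alpha> x))"
    using insert.hyps insert.prems inj
    by (intro ext hypoexponential_density_convolution(2) hypoexponential_density_nonneg) auto
  finally show ?case
    using insert.hyps by simp
qed

subsection \<open>Exponential images of exponential variables\<close>

lemma power_density_nonneg: "0 \<le> l \<Longrightarrow> 0 \<le> power_density k l t"
  by (simp add: power_density_def)

lemma borel_measurable_power_density [measurable]: "power_density k l \<in> borel_measurable borel"
  unfolding power_density_def[abs_def] by measurable

lemma power_density_support:
  assumes "0 < k" "0 < l"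
  shows "{t. power_density k l t \<noteq> 0} = {0<..<1 / k}"
  using assms by (auto simp: power_density_def)

text \<open>This is the distribution function of the power law, needed to identify the law of
  \<open>c * exp (- X)\<close>. The minimum accounts for \<open>a\<close> beyond the right end
  \<open>c\<close> of the support.\<close>

lemma nn_integral_power_density:
  assumes "0 < c" "0 < l"
  shows "(\<integral>\<^sup>+ t. ennreal (power_density (1 / c) l t) * indicator {..a} t \<partial>lborel) =
    ennreal (if a \<le> 0 then 0 else (min a c / c) powr l)"
proof (cases "a \<le> 0")
  case True
  then have "(\<integral>\<^sup>+ t. ennreal (power_density (1 / c) l t) * indicator {..a} t \<partial>lborel) =
      (\<integral>\<^sup>+ t. 0 \<partial>(lborel :: real measure))"
    by (intro nn_integral_cong) (auto simp: power_density_def split: split_indicator)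
  with True show ?thesis by simp
next
  case False
  define b where "b = min a c"
  have b: "0 < b" "b \<le> c"
    using False assms by (auto simp: b_def)
  \<comment> \<open>For \<open>l < 1\<close> the integrand is unbounded near 0; it is still
    integrable because \<open>l - 1 > -1\<close>.\<close>
  have "((\<lambda>t. t powr (l - 1)) has_integral (b powr l / l)) {0..b}"
    using has_integral_powr_from_0[of "l - 1" b] assms b by simp
  then have "((\<lambda>t. l * (1 / c) powr l * t powr (l - 1)) has_integral (l * (1 / c) powr l * (b powr l / l))) {0..b}"
    by (rule has_integral_mult_right)
  also have "l * (1 / c) powr l * (b powr l / l) = (b / c) powr l"
    using assms b by (simp add: powr_divide)
  finally have "(\<integral>\<^sup>+ t. ennreal (l * (1 / c) powr l * t powr (l - 1)) * indicator {0..b} t \<partial>lborel) =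
      ennreal ((b / c) powr l)"
    using assms by (intro nn_integral_has_integral_lebesgue') auto
  \<comment> \<open>The integrands can differ only at \<open>c\<close>, which the support excludes
    and \<open>{0..b}\<close> may include. They agree at 0 because
    \<open>0 powr x = 0\<close>.\<close>
  moreover have "(\<integral>\<^sup>+ t. ennreal (power_density (1 / c) l t) * indicator {..a} t \<partial>lborel) =
      (\<integral>\<^sup>+ t. ennreal (l * (1 / c) powr l * t powr (l - 1)) * indicator {0..b} t \<partial>lborel)"
    using AE_lborel_singleton[of c]
    by (intro nn_integral_cong_AE)
      (auto elim!: eventually_mono simp: power_density_def b_def split: split_indicator)
  ultimately show ?thesis
    using False by (simp add: b_def)
qed

text \<open>Distribution functions are compared: as \<open>exp\<close> is monotone, a lower tail of
  \<open>c * exp (- X)\<close> is an upper tail of \<open>X\<close>, and the exponential survival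
  function turns into a power of \<open>a / c\<close>.\<close>

lemma (in prob_space) distributed_power_exponential:
  assumes X: "distributed M lborel X (exponential_density l)" and "0 < l" "0 < c"
  shows "distributed M lborel (\<lambda>\<omega>. c * exp (- X \<omega>)) (power_density (1 / c) l)"
proof (rule distributedI_borel_atMost[where g = "\<lambda>a. if a \<le> 0 then 0 else (min a c / c) powr l"])
  have [measurable]: "X \<in> borel_measurable M"
    using distributed_measurable[OF X] by simp
  show "(\<lambda>\<omega>. c * exp (- X \<omega>)) \<in> borel_measurable M"
    by measurable
  show "(\<integral>\<^sup>+ t. ennreal (power_density (1 / c) l t * indicator {..a} t) \<partial>lborel) =
    ennreal (if a \<le> 0 then 0 else (min a c / c) powr l)" for a
    unfolding nn_integral_power_density[OF \<open>0 < c\<close> \<open>0 < l\<close>, symmetric]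
    by (intro nn_integral_cong) (simp split: split_indicator)
  show "emeasure M {\<omega> \<in> space M. c * exp (- X \<omega>) \<le> a} =
    ennreal (if a \<le> 0 then 0 else (min a c / c) powr l)" for a
  proof (cases "a \<le> 0")
    case True
    then have "{\<omega> \<in> space M. c * exp (- X \<omega>) \<le> a} = {}"
      using \<open>0 < c\<close> by (auto simp: not_le intro: le_less_trans)
    with True show ?thesis
      by (simp only: if_True emeasure_empty ennreal_0)
  next
    case False
    \<comment> \<open>The threshold for \<open>X\<close>; for \<open>a \<ge> c\<close> it is 0, and
      the event then has full probability.\<close>
    define s where "s = - ln (min a c / c)"
    have s: "0 \<le> s"
      using False \<open>0 < c\<close> by (simp add: s_def ln_le_zero_iff)
    have iff: "c * exp (- x) \<le> a \<longleftrightarrow> - ln (a / c) \<le> x" for x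
    proof -
      have "c * exp (- x) \<le> a \<longleftrightarrow> exp (- x) \<le> a / c"
        using \<open>0 < c\<close> by (simp add: field_simps)
      also have "\<dots> \<longleftrightarrow> - x \<le> ln (a / c)"
        using False \<open>0 < c\<close> by (subst ln_ge_iff) auto
      finally show ?thesis by auto
    qed
    \<comment> \<open>Excluding \<open>X \<omega> = s\<close> replaces the weak inequality by the
      strict one of the survival function; positivity of \<open>X \<omega>\<close> settles the case
      \<open>a > c\<close>.\<close>
    have X_pos: "AE \<omega> in M. 0 < X \<omega> \<and> X \<omega> \<noteq> s"
    proof (rule AE_I'[where N = "{\<omega> \<in> space M. \<not> (0 < X \<omega> \<and> X \<omega> \<noteq> s)}"])
      have "emeasure M (X -` ({..0} \<union> {s}) \<inter> space M) =
          (\<integral>\<^sup>+ x. ennreal (exponential_density l x) * indicator ({..0} \<union> {s}) x \<partial>lborel)"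
        by (rule distributed_emeasure[OF X]) simp
      also have "\<dots> = (\<integral>\<^sup>+ x. 0 \<partial>(lborel :: real measure))"
      proof (rule nn_integral_cong_AE)
        show "AE x in lborel. ennreal (exponential_density l x) * indicator ({..0} \<union> {s}) x = 0"
          using AE_lborel_singleton[of s] AE_lborel_singleton[of 0]
          by eventually_elim (auto simp: exponential_density_def split: split_indicator)
      qed
      also have "X -` ({..0} \<union> {s}) \<inter> space M = {\<omega> \<in> space M. \<not> (0 < X \<omega> \<and> X \<omega> \<noteq> s)}"
        by auto
      finally show "{\<omega> \<in> space M. \<not> (0 < X \<omega> \<and> X \<omega> \<noteq> s)} \<in> null_sets M"
        by (intro null_setsI) auto
    qed auto
    have "emeasure M {\<omega> \<in> space M. c * exp (- X \<omega>) \<le> a} = emeasure M {\<omega> \<in> space M. s < X \<omega>}"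
    proof (rule emeasure_eq_AE)
      show "AE \<omega> in M. \<omega> \<in> {\<omega> \<in> space M. c * exp (- X \<omega>) \<le> a} \<longleftrightarrow> \<omega> \<in> {\<omega> \<in> space M. s < X \<omega>}"
        using X_pos
      proof eventually_elim
        case (elim \<omega>)
        show ?case
        proof (cases "a \<le> c")
          case True
          then show ?thesis
            using elim unfolding mem_Collect_eq iff s_def by auto
        next
          case False
          then have "0 \<le> ln (a / c)"
            using \<open>0 < c\<close> by simp
          then have "- ln (a / c) \<le> X \<omega>"
            using elim by linarith
          then show ?thesis
            using elim False \<open>0 < c\<close> unfolding mem_Collect_eq iff s_def by simp
        qed
      qed
    qed measurable
    also have "\<dots> = ennreal (exp (- s * l))"
      using exponential_distributedD_gt[OF X s \<open>0 < l\<close>] by (simp add: emeasure_eq_measure)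
    also have "exp (- s * l) = (min a c / c) powr l"
      using False \<open>0 < c\<close> by (auto simp: s_def powr_def mult.commute)
    finally show ?thesis
      using False by simp
  qed
qed (use assms in \<open>auto simp: power_density_nonneg\<close>)

subsection \<open>Signed mixtures of densities\<close>

text \<open>\<open>borel\<close> and \<open>lborel\<close> have the same sets, so the two image
  measures agree.\<close>

lemma has_pdf_distr_iff_distributed:
  assumes "\<And>t. 0 \<le> f t" "f \<in> borel_measurable borel" "X \<in> borel_measurable M"
  shows "has_pdf (distr M borel X) f \<longleftrightarrow> distributed M lborel X f"
proof -
  have "distr M borel X = distr M lborel X"
    by (rule distr_cong) auto
  then show ?thesis
    using assms by (auto simp: has_pdf_def distributed_def)
qed

text \<open>Real coefficients of either sign call for the Bochner integral: finiteness of each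
  \<open>N i\<close> makes \<open>f i\<close> integrable, linearity gives the sum, and nonnegativity
  almost everywhere of the whole mixture leads back to \<open>emeasure\<close>.\<close>

lemma emeasure_signed_mixture:
  assumes "\<And>i. i \<in> I \<Longrightarrow> finite_measure (N i)" "\<And>i. i \<in> I \<Longrightarrow> has_pdf (N i) (f i)"
    and Z: "has_pdf Z (\<lambda>t. \<Sum>i\<in>I. A i * f i t)" and B: "B \<in> sets borel"
  shows "emeasure Z B = ennreal (\<Sum>i\<in>I. A i * measure (N i) B)"
proof -
  have f: "has_bochner_integral lborel (\<lambda>t. f i t * indicator B t) (measure (N i) B)" if i: "i \<in> I" for i
  proof (rule has_bochner_integral_nn_integral)
    interpret finite_measure "N i" by (rule assms(1)[OF i])
    have fi: "f i \<in> borel_measurable borel" "AE t in lborel. 0 \<le> f i t"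
      and N: "N i = density lborel (\<lambda>t. ennreal (f i t))"
      using assms(2)[OF i] by (auto simp: has_pdf_def)
    show "(\<lambda>t. f i t * indicator B t) \<in> borel_measurable lborel"
      using fi B by simp
    show "AE t in lborel. 0 \<le> f i t * indicator B t"
      using fi(2) by eventually_elim simp
    have "(\<integral>\<^sup>+ t. ennreal (f i t * indicator B t) \<partial>lborel) = (\<integral>\<^sup>+ t. ennreal (f i t) * indicator B t \<partial>lborel)"
      by (intro nn_integral_cong) (simp split: split_indicator)
    also have "\<dots> = emeasure (N i) B"
      using fi B by (subst N) (simp add: emeasure_density)
    finally show "(\<integral>\<^sup>+ t. ennreal (f i t * indicator B t) \<partial>lborel) = ennreal (measure (N i) B)"
      by (simp add: emeasure_eq_measure)
  qed simp
  have "has_bochner_integral lborel (\<lambda>t. \<Sum>i\<in>I. A i * (f i t * indicator B t)) (\<Sum>i\<in>I. A i * measure (N i) B)"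
    using f by (intro has_bochner_integral_sum has_bochner_integral_mult_right) auto
  then have int: "has_bochner_integral lborel (\<lambda>t. (\<Sum>i\<in>I. A i * f i t) * indicator B t)
      (\<Sum>i\<in>I. A i * measure (N i) B)"
    by (simp add: sum_distrib_right mult.assoc)
  have Z': "(\<lambda>t. \<Sum>i\<in>I. A i * f i t) \<in> borel_measurable borel" "AE t in lborel. 0 \<le> (\<Sum>i\<in>I. A i * f i t)"
      "Z = density lborel (\<lambda>t. ennreal (\<Sum>i\<in>I. A i * f i t))"
    using Z by (auto simp: has_pdf_def)
  have "emeasure Z B = (\<integral>\<^sup>+ t. ennreal ((\<Sum>i\<in>I. A i * f i t) * indicator B t) \<partial>lborel)"
    unfolding Z'(3) using B Z'(1)
    by (subst emeasure_density) (auto intro!: nn_integral_cong split: split_indicator)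
  also have "\<dots> = ennreal (\<Sum>i\<in>I. A i * measure (N i) B)"
    using int Z'(2)
    by (subst nn_integral_eq_integral)
      (auto simp: has_bochner_integral_iff elim!: eventually_mono split: split_indicator)
  finally show ?thesis .
qed

text \<open>The right-hand side contains none of the existentially quantified \<open>A\<close>,
  \<open>f\<close> and \<open>h\<close>, so any two mixed laws with the same \<open>T\<close> and
  \<open>g\<close> coincide.\<close>

lemma (in prob_space) mixed_TG_imp_eq_distr:
  assumes "mixed_TG M I X T g Z"
  shows "Z = distr T borel g"
proof -
  obtain A f h where
    X: "\<And>i. i \<in> I \<Longrightarrow> X i \<in> borel_measurable M" and g: "g \<in> borel_measurable borel"
    and f: "\<And>i. i \<in> I \<Longrightarrow> has_pdf (distr M borel (X i)) (f i)"
    and T: "has_pdf T (\<lambda>t. \<Sum>i\<in>I. A i * f i t)"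
    and h: "\<And>i. i \<in> I \<Longrightarrow> has_pdf (distr M borel (\<lambda>\<omega>. g (X i \<omega>))) (h i)"
    and Z: "has_pdf Z (\<lambda>t. \<Sum>i\<in>I. A i * h i t)"
    using assms unfolding mixed_TG_def by blast
  have gX: "(\<lambda>\<omega>. g (X i \<omega>)) \<in> borel_measurable M" if "i \<in> I" for i
    using measurable_compose[OF X[OF that] g] .
  have sets: "sets T = sets borel" "sets Z = sets borel"
    using T Z by (auto simp: has_pdf_def)
  show ?thesis
  proof (rule measure_eqI)
    fix B assume "B \<in> sets Z"
    then have B: "B \<in> sets borel" by (simp add: sets)
    have gB: "g -` B \<in> sets borel"
      using measurable_sets[OF g B] by simp
    have "emeasure Z B = ennreal (\<Sum>i\<in>I. A i * measure (distr M borel (\<lambda>\<omega>. g (X i \<omega>))) B)"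
      using h Z B gX by (intro emeasure_signed_mixture finite_measure_distr) auto
    also have "\<dots> = ennreal (\<Sum>i\<in>I. A i * measure (distr M borel (X i)) (g -` B))"
      using X gX B gB
      by (intro arg_cong[where f = ennreal] sum.cong) (auto simp: measure_distr intro!: arg_cong[where f = prob])
    also have "\<dots> = emeasure T (g -` B)"
      using f T gB X by (intro emeasure_signed_mixture[symmetric] finite_measure_distr) auto
    also have "\<dots> = emeasure (distr T borel g) B"
      using g B sets sets_eq_imp_space_eq[OF sets(1)] by (subst emeasure_distr) (auto cong: measurable_cong_sets)
    finally show "emeasure Z B = emeasure (distr T borel g) B" .
  qed (simp add: sets)
qed

section \<open>The mixed hypoexponential power distribution\<close>

lemma has_pdf_density:
  "f \<in> borel_measurable borel \<Longrightarrow> AE t in lborel. 0 \<le> f t \<Longrightarrow> has_pdf (density lborel (\<lambda>t. ennreal (f t))) f"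
  by (simp add: has_pdf_def)

text \<open>Change of variables \<open>x = ln (c / t)\<close>, whose derivative in \<open>t\<close>
  has absolute value \<open>1 / t\<close>. It transfers nonnegativity from the hypoexponential
  density to the mixture of power densities.\<close>

lemma power_density_eq_exponential_density:
  assumes "0 < t" "t < c"
  shows "power_density (1 / c) l t = exponential_density l (ln (c / t)) / t"
  using assms by (simp add: power_density_def exponential_density_def powr_diff powr_divide
      powr_def ln_div exp_diff left_diff_distrib exp_minus field_simps)

theorem theorem12:
  fixes M :: "'a measure"
    and X Y :: "nat \<Rightarrow> 'a \<Rightarrow> real"
    and \<alpha> lam :: "nat \<Rightarrow> real"
    and n :: nat
    and c k :: real
  assumes "prob_space M"
    and "2 \<le> n"
    and "\<And>i. i \<in> {1..n} \<Longrightarrow> 0 < \<alpha> i"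
    and "inj_on \<alpha> {1..n}"
    and "0 < c"
    and "prob_space.indep_vars M (\<lambda>_. borel) X {1..n}"
    and "\<And>i. i \<in> {1..n} \<Longrightarrow> distributed M lborel (X i) (exponential_density (\<alpha> i))"
    and "k = 1 / c"
    and "\<And>i. i \<in> {1..n} \<Longrightarrow> lam i = \<alpha> i"
    and "\<And>i \<omega>. i \<in> {1..n} \<Longrightarrow> Y i \<omega> = c * exp (- X i \<omega>)"
  shows "(\<forall>i\<in>{1..n}. distributed M lborel (Y i) (power_density k (lam i)) \<and>
            {t. power_density k (lam i) t \<noteq> 0} = {0<..<c}) \<and>
         (\<exists>!Z. mixed_TG M {1..n} X (hypoexponential n \<alpha>) (\<lambda>x. c * exp (- x)) Z) \<and>
         (\<forall>Z. mixed_TG M {1..n} X (hypoexponential n \<alpha>) (\<lambda>x. c * exp (- x)) Z \<longrightarrow>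
            has_pdf Z (\<lambda>t. \<Sum>i=1..n. 1 / PP n lam i * power_density k (lam i) t))"
  proof -
  interpret prob_space M by fact
  note n = assms(2) and pos = assms(3) and inj = assms(4) and c = assms(5) and indep = assms(6)
    and X = assms(7) and k = assms(8) and lam = assms(9)
  let ?g = "\<lambda>x. c * exp (- x) :: real"
  let ?T = "hypoexponential n \<alpha>"
  let ?pdf = "\<lambda>t. \<Sum>i=1..n. 1 / PP n lam i * power_density k (lam i) t"
  have Xm: "X i \<in> borel_measurable M" if "i \<in> {1..n}" for i
    using distributed_measurable[OF X[OF that]] by simp
  have PP: "PP n lam i = (\<Prod>j\<in>{1..n} - {i}. 1 - \<alpha> i / \<alpha> j)" if "i \<in> {1..n}" for i
    unfolding PP_def using lam that by (intro prod.cong) auto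
  have density_eq: "(\<Sum>i=1..n. 1 / PP n lam i * exponential_density (\<alpha> i) t) =
      hypoexponential_density {1..n} \<alpha> t" for t
    unfolding hypoexponential_density_def by (intro sum.cong) (auto simp: PP)
  have nonneg: "0 \<le> hypoexponential_density {1..n} \<alpha> t" for t
    using inj pos by (intro hypoexponential_density_nonneg) auto
  have gX: "distributed M lborel (\<lambda>\<omega>. c * exp (- X i \<omega>)) (power_density k (lam i))" if "i \<in> {1..n}" for i
    using distributed_power_exponential[OF X[OF that] pos[OF that] c] that by (simp add: k lam)
  have T: "has_pdf ?T (hypoexponential_density {1..n} \<alpha>)"
  proof -
    \<comment> \<open>This moves the law from the product space used in its definition to the given
      variables on \<open>M\<close>.\<close>
    have "?T = distr M borel (\<lambda>\<omega>. \<Sum>i=1..n. X i \<omega>)"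
      using n by (intro distr_sum_eq_hypoexponential[symmetric] assms) auto
    moreover have "distributed M lborel (\<lambda>\<omega>. \<Sum>i=1..n. X i \<omega>) (hypoexponential_density {1..n} \<alpha>)"
      using n inj pos indep X by (intro distributed_sum_exponential) auto
    ultimately show ?thesis
      using nonneg Xm by (simp add: has_pdf_distr_iff_distributed)
  qed
  \<comment> \<open>The signs of the coefficients rule out a termwise argument. On
    \<open>(0, c)\<close> the mixture is the hypoexponential density at \<open>ln (c / t)\<close>
    divided by \<open>t\<close>; elsewhere every term is 0.\<close>
  have pdf_nonneg: "0 \<le> ?pdf t" for t
  proof (cases "0 < t \<and> t < c")
    case True
    then have "?pdf t = hypoexponential_density {1..n} \<alpha> (ln (c / t)) / t"
      unfolding density_eq[symmetric] sum_divide_distrib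
      by (intro sum.cong) (auto simp: k lam power_density_eq_exponential_density)
    with True show ?thesis
      using nonneg by simp
  qed (auto simp: power_density_def k)
  have pdf: "has_pdf (density lborel (\<lambda>t. ennreal (?pdf t))) ?pdf"
    using pdf_nonneg by (intro has_pdf_density) auto
  \<comment> \<open>Existence: the witnesses are \<open>1 / PP n lam i\<close>, the exponential
    densities and the power densities.\<close>
  have "mixed_TG M {1..n} X ?T ?g (density lborel (\<lambda>t. ennreal (?pdf t)))"
    unfolding mixed_TG_def
  proof (intro conjI exI ballI)
    show "inj ?g"
      using c by (auto simp: inj_on_def)
    show "(\<Sum>i=1..n. 1 / PP n lam i) = 1"
      using sum_inverse_prod_one_minus_ratio[of "{1..n}" \<alpha>] n inj pos by (force simp: PP)
    show "has_pdf ?T (\<lambda>t. \<Sum>i=1..n. 1 / PP n lam i * exponential_density (\<alpha> i) t)"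
      using T by (simp only: density_eq)
    show "has_pdf (density lborel (\<lambda>t. ennreal (?pdf t))) ?pdf"
      by (rule pdf)
  next
    fix i assume i: "i \<in> {1..n}"
    show "X i \<in> borel_measurable M"
      using i by (rule Xm)
    show "has_pdf (distr M borel (X i)) (exponential_density (\<alpha> i))"
      using i X pos[OF i] Xm by (simp add: has_pdf_distr_iff_distributed)
    show "has_pdf (distr M borel (\<lambda>\<omega>. ?g (X i \<omega>))) (power_density k (lam i))"
      using i gX[OF i] pos[OF i] Xm[OF i] lam[OF i]
      by (simp add: has_pdf_distr_iff_distributed power_density_nonneg)
  qed auto
  \<comment> \<open>Any such \<open>Z\<close> and the law just constructed both equal the image of
    \<open>?T\<close> under \<open>?g\<close>.\<close>
  moreover from this have unique: "Z = density lborel (\<lambda>t. ennreal (?pdf t))"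
    if "mixed_TG M {1..n} X ?T ?g Z" for Z
    using that mixed_TG_imp_eq_distr by metis
  moreover have "distributed M lborel (Y i) (power_density k (lam i)) \<and>
      {t. power_density k (lam i) t \<noteq> 0} = {0<..<c}" if i: "i \<in> {1..n}" for i
  proof -
    have "Y i = (\<lambda>\<omega>. c * exp (- X i \<omega>))"
      using assms(10)[OF i] by auto
    then show ?thesis
      using gX[OF i] power_density_support[of k "lam i"] c i pos[OF i] by (simp add: k lam)
  qed
  ultimately show ?thesis
    using pdf by blast
qed

end
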